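(* Let $A_1,\ldots,A_k$ be matrices with integer entries, where $A_i$ has dimensions $n_i\times s_i$ for $i=1,\ldots,k$, and let $c_1,\ldots,c_l\in\mathbb{Z}^N$ with $N\ge n_1+\cdots+n_k$. Let $s=s_1+\cdots+s_k+l$, and let $A\in\mathbb{Z}^{N\times s}$ be the matrix whose first $s_1+\cdots+s_k$ columns form the block matrix with $A_1,\ldots,A_k$ placed block-diagonally in the first $n_1+\cdots+n_k$ rows and zeros everywhere else (in particular in the last $N-(n_1+\cdots+n_k)$ rows), and whose last $l$ columns are $c_1,\ldots,c_l$. For each $i$ let $U_i=\{s_1+\cdots+s_{i-1}+1,\ldots,s_1+\cdots+s_i\}$ be the set of indices of the columns in which $A_i$ is located in $A$. Suppose that $$\ker(A)=\ker(A_1)\oplus\cdots\oplus\ker(A_k)\oplus\mathbb{Z}\tau$$ for some $\tau\in\mathbb{Z}^{s}$. If for every $i\in\{1,\ldots,k\}$ the set $U_i$ is disjoint from either $\operatorname{supp}(\tau_+)$ or $\operatorname{supp}(\tau_-)$, then $$I_A=I_{A_1}+\cdots+I_{A_k}+\langle x^{\tau_+}-x^{\tau_-}\rangle.$$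
   Context: $\mathbb{K}$ is an algebraically closed field of characteristic zero. For $\alpha=(a_1,\ldots,a_s)\in\mathbb{Z}^s$, $\operatorname{supp}(\alpha)=\{i : a_i\neq 0\}$, and $\alpha=\alpha_+-\alpha_-$ with $\alpha_+=\sum_{a_i>0}a_i\mathbf{e}_i$ and $\alpha_-=\sum_{a_i<0}(-a_i)\mathbf{e}_i$. For an integer $n\times s$ matrix $A$, $\ker(A)$ denotes the kernel of the induced map $\mathbb{Z}^s\to\mathbb{Z}^n$, and the toric ideal of $A$ is $I_A=\langle x^{\alpha_+}-x^{\alpha_-} : \alpha\in\ker(A)\rangle\subseteq R=\mathbb{K}[x_1,\ldots,x_s]$. Here $\ker(A_i)\subseteq\mathbb{Z}^{s_i}$ is regarded as a subgroup of $\mathbb{Z}^s$ by placing its coordinates in the positions $U_i$ and zeros elsewhere, and $I_{A_i}$ is regarded as an ideal of $R=\mathbb{K}[x_1,\ldots,x_s]$ (i.e. the ideal generated by the toric ideal of $A_i$ in the variables $x_j$, $j\in U_i$). *)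

theory Defs
  imports
    "Jordan_Normal_Form.Matrix_Kernel"
    "HOL-Library.Poly_Mapping"
    "HOL-Algebra.Ideal"
begin

text \<open>
  All indices start at 0: vector coordinates, matrix columns, and variables, so that
  \<open>R = \<bbbK>[x\<^sub>0, \<dots>, x\<^sub>s\<^sub>-\<^sub>1]\<close>.
\<close>

section \<open>Integer vectors\<close>

text \<open>\<open>pos_part \<alpha>\<close> and \<open>neg_part \<alpha>\<close> are \<open>\<alpha>\<^sub>+\<close> and \<open>\<alpha>\<^sub>-\<close>; both work because \<^const>\<open>nat\<close> sends
  negative integers to 0.\<close>

definition pos_part :: "int vec \<Rightarrow> nat vec" where
  "pos_part \<alpha> = map_vec nat \<alpha>"

definition neg_part :: "int vec \<Rightarrow> nat vec" where
  "neg_part \<alpha> = map_vec (\<lambda>a. nat (- a)) \<alpha>"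

definition supp :: "'a::zero vec \<Rightarrow> nat set" where
  "supp v = {i. i < dim_vec v \<and> v $ i \<noteq> 0}"

definition embed_vec :: "nat \<Rightarrow> nat \<Rightarrow> 'a::zero vec \<Rightarrow> 'a vec" where
  "embed_vec s off v =
     vec s (\<lambda>j. if off \<le> j \<and> j < off + dim_vec v then v $ (j - off) else 0)"

text \<open>The subgroup \<open>G\<close> of \<open>\<int>\<^sup>s\<close> is the internal direct sum of the subgroups \<open>H\<^sub>1, \<dots>, H\<^sub>m\<close>: every
  element of \<open>G\<close> is \<open>h\<^sub>1 + \<dots> + h\<^sub>m\<close> for exactly one choice of \<open>h\<^sub>j \<in> H\<^sub>j\<close>, and all such sums
  lie in \<open>G\<close>.\<close>

definition internal_direct_sum :: "nat \<Rightarrow> int vec set list \<Rightarrow> int vec set \<Rightarrow> bool" where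
  "internal_direct_sum s Hs G \<longleftrightarrow>
     bij_betw (\<lambda>hs. foldr (+) hs (0\<^sub>v s)) (listset Hs) G"


section \<open>Polynomials and toric ideals\<close>

type_synonym 'k mpoly = "(nat \<Rightarrow>\<^sub>0 nat) \<Rightarrow>\<^sub>0 'k"

text \<open>\<open>mpoly_ring V\<close> is \<open>\<bbbK>[x\<^sub>j : j \<in> V]\<close>, with the convolution product of \<^type>\<open>poly_mapping\<close>.\<close>

definition mpoly_ring :: "nat set \<Rightarrow> 'k::comm_ring_1 mpoly ring" where
  "mpoly_ring V =
     \<lparr>carrier = {p. \<forall>m\<in>Poly_Mapping.keys p. Poly_Mapping.keys m \<subseteq> V},
      mult = (*), one = 1, zero = 0, add = (+)\<rparr>"

lemma mpoly_ring_cring: "cring (mpoly_ring V :: 'k::comm_ring_1 mpoly ring)"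
proof (rule cringI)
  let ?R = "mpoly_ring V :: 'k mpoly ring"
  show "abelian_group ?R"
  proof (rule abelian_groupI)
    show "\<exists>y\<in>carrier ?R. y \<oplus>\<^bsub>?R\<^esub> x = \<zero>\<^bsub>?R\<^esub>" if "x \<in> carrier ?R" for x
      using that by (intro bexI[of _ "- x"]) (auto simp: mpoly_ring_def keys_def)
  qed (use Poly_Mapping.keys_add in \<open>fastforce simp: mpoly_ring_def ac_simps\<close>)+
  show "Group.comm_monoid ?R"
  proof (rule comm_monoidI)
    show "x \<otimes>\<^bsub>?R\<^esub> y \<in> carrier ?R" if xy: "x \<in> carrier ?R" "y \<in> carrier ?R" for x y
    proof -
      have "Poly_Mapping.keys m \<subseteq> V" if m: "m \<in> Poly_Mapping.keys (x * y)" for m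
      proof -
        obtain a b where "m = a + b" "a \<in> Poly_Mapping.keys x" "b \<in> Poly_Mapping.keys y"
          using m keys_mult[of x y] by blast
        then show ?thesis using xy Poly_Mapping.keys_add[of a b] by (fastforce simp: mpoly_ring_def)
      qed
      then show ?thesis by (auto simp: mpoly_ring_def)
    qed
  qed (auto simp: mpoly_ring_def ac_simps)
qed (auto simp: mpoly_ring_def algebra_simps)

text \<open>The monomial \<open>x\<^sup>a\<close> whose exponent vector \<open>a\<close> is read in the variables
  \<open>x\<^sub>o\<^sub>f\<^sub>f, x\<^sub>o\<^sub>f\<^sub>f\<^sub>+\<^sub>1, \<dots>\<close>.\<close>

definition monomial_at :: "nat \<Rightarrow> nat vec \<Rightarrow> 'k::comm_ring_1 mpoly" where
  "monomial_at off a =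
     Poly_Mapping.single (\<Sum>c<dim_vec a. Poly_Mapping.single (off + c) (a $ c)) 1"

definition pure_binomial :: "nat \<Rightarrow> int vec \<Rightarrow> 'k::comm_ring_1 mpoly" where
  "pure_binomial off \<alpha> = monomial_at off (pos_part \<alpha>) - monomial_at off (neg_part \<alpha>)"

text \<open>The toric ideal of \<open>A\<close> in \<open>\<bbbK>[x\<^sub>o\<^sub>f\<^sub>f, \<dots>, x\<^sub>o\<^sub>f\<^sub>f\<^sub>+\<^sub>d\<^sub>-\<^sub>1]\<close>, where column \<open>c\<close> of the \<open>d\<close> columns of \<open>A\<close>
  corresponds to the variable \<open>x\<^sub>o\<^sub>f\<^sub>f\<^sub>+\<^sub>c\<close>. With \<open>off = 0\<close> it is the toric ideal \<open>I\<^sub>A\<close>.\<close>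

definition toric_ideal_at :: "nat \<Rightarrow> int mat \<Rightarrow> 'k::comm_ring_1 mpoly set" where
  "toric_ideal_at off A =
     genideal (mpoly_ring {off..<off + dim_col A}) (pure_binomial off ` mat_kernel A)"

abbreviation toric_ideal :: "int mat \<Rightarrow> 'k::comm_ring_1 mpoly set" where
  "toric_ideal A \<equiv> toric_ideal_at 0 A"


section \<open>The block matrix\<close>

definition bordered_block_mat :: "nat \<Rightarrow> int mat list \<Rightarrow> int vec list \<Rightarrow> int mat" where
  "bordered_block_mat N As cs =
     (let D = diag_block_mat As
      in mat_of_cols N (map (\<lambda>v. v @\<^sub>v 0\<^sub>v (N - dim_row D)) (cols D) @ cs))"

definition block_offset :: "int mat list \<Rightarrow> nat \<Rightarrow> nat" where
  "block_offset As i = sum_list (map dim_col (take i As))"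

definition block_cols :: "int mat list \<Rightarrow> nat \<Rightarrow> nat set" where
  "block_cols As i = {block_offset As i..<block_offset As i + dim_col (As ! i)}"

definition block_kernel :: "nat \<Rightarrow> int mat list \<Rightarrow> nat \<Rightarrow> int vec set" where
  "block_kernel s As i = embed_vec s (block_offset As i) ` mat_kernel (As ! i)"

definition block_toric_ideal :: "nat \<Rightarrow> int mat list \<Rightarrow> nat \<Rightarrow> 'k::comm_ring_1 mpoly set" where
  "block_toric_ideal s As i =
     genideal (mpoly_ring {..<s}) (toric_ideal_at (block_offset As i) (As ! i))"

end

theory Submission
  imports Defs
begin

text \<open>
  Let \<open>J\<close> be the sum on the right-hand side and write \<open>p \<sim> q\<close> for \<open>x\<^sup>p - x\<^sup>q \<in> J\<close>. If \<open>p - q\<close>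
  is a sum of elements of the block kernels, then \<open>p \<sim> q\<close>, because one can change \<open>q\<close> into \<open>p\<close>
  block by block without leaving the nonnegative vectors; likewise if \<open>p - q\<close> is a multiple of
  \<open>\<tau>\<close>. In general \<open>p - q = \<beta> + m\<tau>\<close> with \<open>\<beta>\<close> of the first kind and, by symmetry, \<open>m \<ge> 0\<close>.
  Replace \<open>p\<close> by \<open>q + m\<tau>\<^sub>+\<close> on the blocks where \<open>\<tau> \<ge> 0\<close>, and \<open>q\<close> by \<open>p + m\<tau>\<^sub>-\<close> on the
  remaining blocks, where \<open>\<tau> \<le> 0\<close>; the last \<open>l\<close> coordinates, on which \<open>\<beta> = 0\<close>, can be treated
  one by one. Both replacements change the vectors by sums of elements of
  block kernels, and the new vectors differ by exactly \<open>m\<tau>\<close>.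
\<close>

section \<open>Ideals of polynomial rings\<close>

lemma mpoly_ring_simps [simp]:
  "mult (mpoly_ring V) = (*)" "one (mpoly_ring V) = 1"
  "zero (mpoly_ring V) = 0" "add (mpoly_ring V) = (+)"
  by (simp_all add: mpoly_ring_def)

lemma mpoly_ring_ring: "ring (mpoly_ring V)"
  using mpoly_ring_cring by (rule cring.axioms)

lemma mpoly_ring_carrier_uminus:
  "a \<in> carrier (mpoly_ring V) \<Longrightarrow> - a \<in> carrier (mpoly_ring V)"
  by (auto simp: mpoly_ring_def keys_def)

lemma mpoly_ring_carrier_diff:
  assumes "a \<in> carrier (mpoly_ring V)" "b \<in> carrier (mpoly_ring V)"
  shows "a - b \<in> carrier (mpoly_ring V)"
proof -
  interpret ring "mpoly_ring V :: 'a mpoly ring" by (rule mpoly_ring_ring)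
  show ?thesis
    using a_closed[OF assms(1) mpoly_ring_carrier_uminus[OF assms(2)]] by simp
qed

lemma mpoly_ring_carrier_mono:
  "V \<subseteq> W \<Longrightarrow> carrier (mpoly_ring V) \<subseteq> carrier (mpoly_ring W)"
  by (auto simp: mpoly_ring_def)

text \<open>Since -1 is a polynomial of every \<open>mpoly_ring V\<close>, closure under
  multiplication already yields closure under negation.\<close>

lemma mpoly_idealI:
  fixes J :: "'k::comm_ring_1 mpoly set"
  assumes "J \<subseteq> carrier (mpoly_ring V)" and "0 \<in> J"
    and "\<And>a b. a \<in> J \<Longrightarrow> b \<in> J \<Longrightarrow> a + b \<in> J"
    and mult: "\<And>a x. a \<in> J \<Longrightarrow> x \<in> carrier (mpoly_ring V) \<Longrightarrow> x * a \<in> J"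
  shows "ideal J (mpoly_ring V)"
proof -
  let ?R = "mpoly_ring V :: 'k mpoly ring"
  interpret ring ?R by (rule mpoly_ring_ring)
  have minus: "- a \<in> J" if "a \<in> J" for a
    using mult[OF that mpoly_ring_carrier_uminus[OF one_closed]] by simp
  show ?thesis
  proof (rule idealI[OF mpoly_ring_ring])
    show "subgroup J (add_monoid ?R)"
    proof (rule group.subgroupI[OF a_group])
      show "inv\<^bsub>add_monoid ?R\<^esub> a \<in> J" if a: "a \<in> J" for a
      proof -
        have "a \<in> carrier ?R" using a assms(1) by blast
        then have "\<ominus>\<^bsub>?R\<^esub> a = - a"
          using minus_equality[of "- a" a] mpoly_ring_carrier_uminus[of a V] by simp
        then show ?thesis using minus[OF a] by (simp add: a_inv_def)
      qed
    qed (use assms in auto)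
  qed (use assms in \<open>auto simp: mult.commute\<close>)
qed

locale mpoly_ideal =
  fixes V :: "nat set" and J :: "'k::comm_ring_1 mpoly set"
  assumes ideal: "ideal J (mpoly_ring V)"
begin

lemma zero_mem: "0 \<in> J"
  using additive_subgroup.zero_closed[OF ideal.axioms(1)[OF ideal]] by simp

lemma add_mem: "a \<in> J \<Longrightarrow> b \<in> J \<Longrightarrow> a + b \<in> J"
  using additive_subgroup.a_closed[OF ideal.axioms(1)[OF ideal]] by fastforce

lemma mult_mem: "a \<in> J \<Longrightarrow> x \<in> carrier (mpoly_ring V) \<Longrightarrow> x * a \<in> J"
  using ideal.I_l_closed[OF ideal] by fastforce

lemma uminus_mem:
  assumes "a \<in> J"
  shows "- a \<in> J"
proof -
  interpret ring "mpoly_ring V :: 'k mpoly ring" by (rule mpoly_ring_ring)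
  show ?thesis
    using mult_mem[OF assms mpoly_ring_carrier_uminus[OF one_closed]] by simp
qed

text \<open>A toric ideal is generated in the ring of its own variables but compared with ideals of
  a larger ring; contraction brings both into the same ring.\<close>

lemma ideal_contract:
  assumes "W \<subseteq> V"
  shows "ideal (J \<inter> carrier (mpoly_ring W)) (mpoly_ring W)"
proof -
  interpret W: ring "mpoly_ring W :: 'k mpoly ring" by (rule mpoly_ring_ring)
  show ?thesis
    using mpoly_ring_carrier_mono[OF assms] zero_mem add_mem mult_mem
      W.zero_closed W.a_closed W.m_closed
    by (intro mpoly_idealI) auto
qed

end

section \<open>Finite sums of ideals\<close>

lemma foldr_set_add_ideals:
  fixes R (structure)
  assumes R: "ring R" and "ideal G R" and "\<And>I. I \<in> set Is \<Longrightarrow> ideal I R"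
  shows "ideal (foldr (set_add R) Is G) R"
    and "G \<union> \<Union>(set Is) \<subseteq> foldr (set_add R) Is G"
proof -
  interpret ring R by fact
  have "ideal (foldr (set_add R) Is G) R \<and> G \<union> \<Union>(set Is) \<subseteq> foldr (set_add R) Is G"
    using assms(3)
  proof (induction Is)
    case Nil
    then show ?case using assms(2) by simp
  next
    case (Cons I Is)
    let ?F = "foldr (set_add R) Is G"
    have I: "ideal I R" and F: "ideal ?F R" and sub: "G \<union> \<Union>(set Is) \<subseteq> ?F"
      using Cons by auto
    \<comment> \<open>The sum of two ideals is the ideal generated by their union, hence contains
      both.\<close>
    have "I \<union> ?F \<subseteq> I <+> ?F"
      using genideal_self[of "I \<union> ?F"] union_genideal[OF I F]
        additive_subgroup.a_subset[OF ideal.axioms(1)[OF I]]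
        additive_subgroup.a_subset[OF ideal.axioms(1)[OF F]] by simp
    then show ?case using add_ideals[OF I F] sub by auto
  qed
  then show "ideal (foldr (set_add R) Is G) R"
    and "G \<union> \<Union>(set Is) \<subseteq> foldr (set_add R) Is G" by auto
qed

text \<open>An ideal is closed under addition, so all partial sums stay in \<open>K\<close>.
  Together with \<open>foldr_set_add_ideals\<close>, a folded sum of ideals is the smallest ideal
  containing them.\<close>

lemma foldr_set_add_least:
  fixes R (structure)
  assumes K: "ideal K R" and "G \<subseteq> K" and "\<And>I. I \<in> set Is \<Longrightarrow> I \<subseteq> K"
  shows "foldr (set_add R) Is G \<subseteq> K"
  using assms(3)
proof (induction Is)
  case (Cons I Is)
  then have "I \<subseteq> K" "foldr (set_add R) Is G \<subseteq> K" by auto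
  then have "h \<oplus> k \<in> K" if "h \<in> I" "k \<in> foldr (set_add R) Is G" for h k
    using that additive_subgroup.a_closed[OF ideal.axioms(1)[OF K]] by blast
  then show ?case by (auto simp: set_add_def'[of R I])
qed (use assms(2) in simp)


section \<open>Monomials and binomials\<close>

lemma monomial_at_add:
  assumes "dim_vec a = dim_vec b"
  shows "monomial_at off (a + b) = monomial_at off a * monomial_at off b"
proof -
  have "(\<Sum>c<dim_vec b. Poly_Mapping.single (off + c) ((a + b) $ c)) =
      (\<Sum>c<dim_vec a. Poly_Mapping.single (off + c) (a $ c)) +
      (\<Sum>c<dim_vec b. Poly_Mapping.single (off + c) (b $ c))"
    by (simp add: assms single_add sum.distrib)
  then show ?thesis by (simp add: monomial_at_def mult_single)
qed

lemma monomial_at_carrier: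
  "monomial_at off a \<in> carrier (mpoly_ring {off..<off + dim_vec a})"
proof -
  let ?e = "\<Sum>c<dim_vec a. Poly_Mapping.single (off + c) (a $ c)"
  have "Poly_Mapping.keys ?e \<subseteq> {off..<off + dim_vec a}"
    using Poly_Mapping.keys_sum[of "\<lambda>c. Poly_Mapping.single (off + c) (a $ c)" "{..<dim_vec a}"]
    by (fastforce split: if_splits)
  then show ?thesis by (auto simp: monomial_at_def mpoly_ring_def)
qed

text \<open>Padding only adds exponents 0, and these contribute nothing. This links the variables of
  a block to vectors of full length.\<close>

lemma monomial_at_embed_vec:
  assumes "off + dim_vec a \<le> s"
  shows "monomial_at 0 (embed_vec s off a) = monomial_at off a"
proof -
  let ?f = "\<lambda>c. Poly_Mapping.single c (embed_vec s off a $ c)"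
  have "sum ?f {..<s} = sum ?f {off..<off + dim_vec a}"
    using assms by (intro sum.mono_neutral_right) (auto simp: embed_vec_def)
  also have "\<dots> = (\<Sum>c<dim_vec a. Poly_Mapping.single (off + c) (a $ c))"
    using assms
    by (intro sum.reindex_bij_witness[of _ "\<lambda>c. off + c" "\<lambda>c. c - off"])
       (auto simp: embed_vec_def)
  finally show ?thesis by (simp add: monomial_at_def embed_vec_def)
qed

lemma dim_parts [simp]: "dim_vec (pos_part \<alpha>) = dim_vec \<alpha>" "dim_vec (neg_part \<alpha>) = dim_vec \<alpha>"
  by (simp_all add: pos_part_def neg_part_def)

lemma index_parts [simp]:
  "j < dim_vec \<alpha> \<Longrightarrow> pos_part \<alpha> $ j = nat (\<alpha> $ j)"
  "j < dim_vec \<alpha> \<Longrightarrow> neg_part \<alpha> $ j = nat (- (\<alpha> $ j))"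
  by (simp_all add: pos_part_def neg_part_def)

lemma pure_binomial_carrier:
  "pure_binomial off \<alpha> \<in> carrier (mpoly_ring {off..<off + dim_vec \<alpha>})"
  using mpoly_ring_carrier_diff[OF monomial_at_carrier[of off "pos_part \<alpha>"],
      of "monomial_at off (neg_part \<alpha>)"] monomial_at_carrier[of off "neg_part \<alpha>"]
  by (simp add: pure_binomial_def)

lemma pure_binomial_embed_vec:
  assumes "off + dim_vec \<alpha> \<le> s"
  shows "pure_binomial 0 (embed_vec s off \<alpha>) = pure_binomial off \<alpha>"
proof -
  \<comment> \<open>Both coordinate functions send 0 to 0, so taking parts commutes with
    padding.\<close>
  have "pos_part (embed_vec s off \<alpha>) = embed_vec s off (pos_part \<alpha>)"
       "neg_part (embed_vec s off \<alpha>) = embed_vec s off (neg_part \<alpha>)"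
    by (auto simp: embed_vec_def intro!: eq_vecI)
  then show ?thesis
    using assms by (simp add: pure_binomial_def monomial_at_embed_vec)
qed

section \<open>Exponent vectors modulo an ideal\<close>

locale mpoly_ideal_lessThan = mpoly_ideal "{..<s}" J
  for s :: nat and J :: "'k::comm_ring_1 mpoly set"
begin

text \<open>The relation ~ of the outline: equality of monomials in the quotient by
  \<open>J\<close>.\<close>

definition cong :: "nat vec \<Rightarrow> nat vec \<Rightarrow> bool" where
  "cong p q \<longleftrightarrow> monomial_at 0 p - monomial_at 0 q \<in> J"

lemma cong_refl: "cong p p"
  using zero_mem by (simp add: cong_def)

lemma cong_sym: "cong p q \<Longrightarrow> cong q p"
  using uminus_mem[of "monomial_at 0 p - monomial_at 0 q"] by (simp add: cong_def)

lemma cong_trans: "cong p q \<Longrightarrow> cong q r \<Longrightarrow> cong p r"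
  using add_mem[of "monomial_at 0 p - monomial_at 0 q" "monomial_at 0 q - monomial_at 0 r"]
  by (simp add: cong_def)

lemma cong_parts_iff: "cong (pos_part \<alpha>) (neg_part \<alpha>) \<longleftrightarrow> pure_binomial 0 \<alpha> \<in> J"
  by (simp add: cong_def pure_binomial_def)

text \<open>Dividing both monomials by x^z, with z the coordinatewise minimum of \<open>p\<close>
  and \<open>q\<close>, leaves the two parts of \<alpha>; so x^p - x^q is x^z times a binomial of
  \<open>J\<close>.\<close>

lemma cong_if_pure_binomial:
  assumes \<alpha>: "pure_binomial 0 \<alpha> \<in> J" "\<alpha> \<in> carrier_vec s"
    and pq: "p \<in> carrier_vec s" "q \<in> carrier_vec s"
    and diff: "\<And>j. j < s \<Longrightarrow> int (p $ j) - int (q $ j) = \<alpha> $ j"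
  shows "cong p q"
proof -
  define z where "z = vec s (\<lambda>j. min (p $ j) (q $ j))"
  have "p = z + pos_part \<alpha>"
    using \<alpha>(2) pq diff by (auto simp: z_def min_def simp flip: diff intro!: eq_vecI)
  moreover have "q = z + neg_part \<alpha>"
    using \<alpha>(2) pq diff by (auto simp: z_def min_def simp flip: diff intro!: eq_vecI)
  moreover have "dim_vec z = s" by (simp add: z_def)
  ultimately have "(monomial_at 0 p - monomial_at 0 q :: 'k mpoly) = monomial_at 0 z * pure_binomial 0 \<alpha>"
    using \<alpha>(2) by (simp add: monomial_at_add pure_binomial_def algebra_simps)
  moreover have "(monomial_at 0 z :: 'k mpoly) \<in> carrier (mpoly_ring {..<s})"
    using monomial_at_carrier[of 0 z] \<open>dim_vec z = s\<close> by (simp add: atLeast0LessThan)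
  ultimately show ?thesis
    using mult_mem[OF \<alpha>(1)] by (simp add: cong_def)
qed

text \<open>Copies of \<alpha> are removed from \<open>p\<close> one at a time. The intermediate
  vectors lie coordinatewise between \<open>q\<close> and \<open>p\<close>, so they stay
  nonnegative.\<close>

lemma cong_if_multiple:
  assumes \<alpha>: "pure_binomial 0 \<alpha> \<in> J" "\<alpha> \<in> carrier_vec s"
    and "p \<in> carrier_vec s" "q \<in> carrier_vec s"
    and "\<And>j. j < s \<Longrightarrow> int (p $ j) - int (q $ j) = int m * \<alpha> $ j"
  shows "cong p q"
  using assms(3-)
proof (induction m arbitrary: p)
  case 0
  then have "p = q" by (intro eq_vecI) auto
  then show ?case by (simp add: cong_refl)
next
  case (Suc m)
  define p' where "p' = vec s (\<lambda>j. nat (int (p $ j) - \<alpha> $ j))"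
  have p': "p' \<in> carrier_vec s" by (simp add: p'_def)
  have eq: "int (p' $ j) = int (p $ j) - \<alpha> $ j" if "j < s" for j
  proof -
    have d: "int (p $ j) = int (q $ j) + int m * \<alpha> $ j + \<alpha> $ j"
      using Suc.prems(3)[OF that] by (simp add: algebra_simps)
    \<comment> \<open>For \<alpha> $ j \<ge> 0 the difference is q $ j + m * \<alpha> $ j; otherwise
      subtracting \<alpha> $ j increases p $ j.\<close>
    have "0 \<le> int (p $ j) - \<alpha> $ j"
    proof (cases "0 \<le> \<alpha> $ j")
      case True
      then have "0 \<le> int m * \<alpha> $ j" by simp
      then show ?thesis using d by linarith
    qed linarith
    then show ?thesis using that by (simp add: p'_def)
  qed
  have "cong p p'"
    using eq by (intro cong_if_pure_binomial[OF \<alpha> Suc.prems(1) p']) simp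
  moreover have "cong p' q"
    using eq Suc.prems by (intro Suc.IH p') (auto simp: algebra_simps)
  ultimately show ?case by (rule cong_trans)
qed

end


section \<open>Sums of block kernels\<close>

lemma mat_kernel_zero: "0\<^sub>v (dim_col A) \<in> mat_kernel A"
  by (auto simp: mat_kernel_def)

lemma mat_kernel_add: "v \<in> mat_kernel A \<Longrightarrow> w \<in> mat_kernel A \<Longrightarrow> v + w \<in> mat_kernel A"
  by (auto simp: mat_kernel_def mult_add_distrib_mat_vec[of A "dim_row A" "dim_col A"])

lemma block_offset_Suc:
  "i < length As \<Longrightarrow> block_offset As (Suc i) = block_offset As i + dim_col (As ! i)"
  by (simp add: block_offset_def take_Suc_conv_app_nth)

lemma block_offset_mono: "i \<le> j \<Longrightarrow> block_offset As i \<le> block_offset As j"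
proof -
  assume "i \<le> j"
  then have "take j As = take i As @ take (j - i) (drop i As)"
    by (metis take_add le_add_diff_inverse)
  then show ?thesis by (simp add: block_offset_def)
qed

lemma block_offset_length: "block_offset As (length As) = sum_list (map dim_col As)"
  by (simp add: block_offset_def)

lemma block_bound:
  "i < length As \<Longrightarrow> block_offset As i + dim_col (As ! i) \<le> sum_list (map dim_col As)"
  using block_offset_mono[of "Suc i" "length As" As]
  by (simp add: block_offset_Suc block_offset_length)

lemma block_cols_disjoint:
  assumes "i < length As" "i' < length As" "i \<noteq> i'"
  shows "block_cols As i \<inter> block_cols As i' = {}"
  using assms block_offset_mono[of "Suc i" i' As] block_offset_mono[of "Suc i'" i As]
  by (cases "i < i'") (auto simp: block_cols_def block_offset_Suc)

text \<open>A left inverse of \<open>embed_vec s (block_offset As i)\<close> on vectors of length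
  \<open>dim_col (As ! i)\<close>, provided the block fits into s coordinates.\<close>

definition block_vec :: "int mat list \<Rightarrow> nat \<Rightarrow> int vec \<Rightarrow> int vec" where
  "block_vec As i v = vec (dim_col (As ! i)) (\<lambda>c. v $ (block_offset As i + c))"

text \<open>If the blocks fit into s coordinates, this is the sum of the embedded kernels. The
  coordinatewise form lets a vector be cut along blocks without choosing summands.\<close>

definition block_kernel_sum :: "nat \<Rightarrow> int mat list \<Rightarrow> int vec set" where
  "block_kernel_sum s As = {v \<in> carrier_vec s.
     (\<forall>i<length As. block_vec As i v \<in> mat_kernel (As ! i)) \<and>
     (\<forall>j. sum_list (map dim_col As) \<le> j \<and> j < s \<longrightarrow> v $ j = 0)}"

lemma zero_block_kernel_sum:
  assumes "sum_list (map dim_col As) \<le> s"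
  shows "0\<^sub>v s \<in> block_kernel_sum s As"
proof -
  have "block_vec As i (0\<^sub>v s) = 0\<^sub>v (dim_col (As ! i))" if "i < length As" for i
    using block_bound[OF that] assms by (auto simp: block_vec_def)
  then show ?thesis by (simp add: block_kernel_sum_def mat_kernel_zero)
qed

lemma add_block_kernel_sum:
  assumes "sum_list (map dim_col As) \<le> s"
    and v: "v \<in> block_kernel_sum s As" and w: "w \<in> block_kernel_sum s As"
  shows "v + w \<in> block_kernel_sum s As"
proof -
  have "block_vec As i (v + w) = block_vec As i v + block_vec As i w" if "i < length As" for i
    using block_bound[OF that] assms(1) w by (auto simp: block_vec_def block_kernel_sum_def)
  then show ?thesis using v w by (auto simp: block_kernel_sum_def mat_kernel_add)
qed

lemma uminus_block_kernel_sum: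
  assumes "sum_list (map dim_col As) \<le> s" and v: "v \<in> block_kernel_sum s As"
  shows "- v \<in> block_kernel_sum s As"
proof -
  \<comment> \<open>Negation is written as scaling by -1 because kernels are closed under
    scaling.\<close>
  have "block_vec As i (- v) = (- 1) \<cdot>\<^sub>v block_vec As i v" if "i < length As" for i
    using block_bound[OF that] assms by (auto simp: block_vec_def block_kernel_sum_def)
  then show ?thesis
    using v mat_kernel_smult[OF carrier_matI[OF refl refl], of "block_vec As i v" "As ! i" "- 1" for i]
    by (auto simp: block_kernel_sum_def)
qed

text \<open>Blocks are disjoint, so a padded kernel vector restricts to itself on its own block and
  to zero on all others.\<close>

lemma block_kernel_subset_sum:
  assumes s: "sum_list (map dim_col As) \<le> s" and i: "i < length As"
  shows "block_kernel s As i \<subseteq> block_kernel_sum s As"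
proof
  fix v assume "v \<in> block_kernel s As i"
  then obtain u where u: "u \<in> mat_kernel (As ! i)" and v: "v = embed_vec s (block_offset As i) u"
    by (auto simp: block_kernel_def)
  have dim: "dim_vec u = dim_col (As ! i)" using u by (auto simp: mat_kernel_def)
  have "block_vec As i' v \<in> mat_kernel (As ! i')" if i': "i' < length As" for i'
  proof (cases "i' = i")
    case True
    have "block_vec As i v = u"
      using dim block_bound[OF i] s by (auto simp: v block_vec_def embed_vec_def)
    then show ?thesis using u True by simp
  next
    case False
    have "block_vec As i' v = 0\<^sub>v (dim_col (As ! i'))"
    proof (rule eq_vecI)
      fix c assume "c < dim_vec (0\<^sub>v (dim_col (As ! i')) :: int vec)"
      then have c: "block_offset As i' + c \<in> block_cols As i'" "c < dim_col (As ! i')"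
        by (auto simp: block_cols_def)
      then have "block_offset As i' + c \<notin> block_cols As i"
        using block_cols_disjoint[OF i i'] False by blast
      then show "block_vec As i' v $ c = 0\<^sub>v (dim_col (As ! i')) $ c"
        using c dim block_bound[OF i'] s
        by (auto simp: v block_vec_def embed_vec_def block_cols_def)
    qed (simp add: block_vec_def)
    then show ?thesis by (simp add: mat_kernel_zero)
  qed
  moreover have "v $ j = 0" if "sum_list (map dim_col As) \<le> j" "j < s" for j
    using that block_bound[OF i] dim by (auto simp: v embed_vec_def)
  ultimately show "v \<in> block_kernel_sum s As"
    by (auto simp: block_kernel_sum_def v embed_vec_def)
qed

section \<open>Congruences from block kernels and multiples of \<tau>\<close>

lemma (in mpoly_ideal_lessThan) cong_if_block_kernel_sum:
  assumes s: "sum_list (map dim_col As) \<le> s"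
    and gens: "\<And>i \<alpha>. i < length As \<Longrightarrow> \<alpha> \<in> block_kernel s As i \<Longrightarrow> pure_binomial 0 \<alpha> \<in> J"
    and v: "v \<in> block_kernel_sum s As"
    and pq: "p \<in> carrier_vec s" "q \<in> carrier_vec s"
    and diff: "\<And>j. j < s \<Longrightarrow> int (p $ j) - int (q $ j) = v $ j"
  shows "cong p q"
proof -
  \<comment> \<open>Pass from \<open>q\<close> to \<open>p\<close> one block at a time: \<open>r n\<close> agrees with \<open>p\<close> on the first \<open>n\<close> blocks.\<close>
  define r where "r n = vec s (\<lambda>j. if j < block_offset As n then p $ j else q $ j)" for n
  have r_carrier: "r n \<in> carrier_vec s" for n by (simp add: r_def)
  have "cong (r n) q" if "n \<le> length As" for n
    using that
  proof (induction n)
    case 0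
    have "r 0 = q" using pq by (auto simp: r_def block_offset_def)
    then show ?case by (simp add: cong_refl)
  next
    case (Suc n)
    let ?u = "embed_vec s (block_offset As n) (block_vec As n v)"
    have n: "n < length As" using Suc.prems by simp
    \<comment> \<open>\<open>?u\<close> is the part of p - q inside block \<open>n\<close>, which is
      the difference of \<open>r (Suc n)\<close> and \<open>r n\<close>.\<close>
    have "?u \<in> block_kernel s As n"
      using v n by (auto simp: block_kernel_def block_kernel_sum_def)
    then have "cong (r (Suc n)) (r n)"
      using block_offset_Suc[OF n] diff
      by (intro cong_if_pure_binomial[OF gens[OF n] _ r_carrier r_carrier])
         (auto simp: r_def embed_vec_def block_vec_def)
    then show ?case using Suc n by (auto intro: cong_trans)
  qed
  moreover have "r (length As) = p"
  proof (rule eq_vecI)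
    fix j assume "j < dim_vec p"
    then have j: "j < s" using pq by simp
    show "r (length As) $ j = p $ j"
    proof (cases "j < sum_list (map dim_col As)")
      case False
      \<comment> \<open>Past the last block \<open>p\<close> and \<open>q\<close> already
        agree.\<close>
      then have "v $ j = 0" using v j by (simp add: block_kernel_sum_def)
      then show ?thesis using diff[OF j] j by (simp add: r_def)
    qed (use j in \<open>simp add: r_def block_offset_length\<close>)
  qed (use pq in \<open>simp add: r_def\<close>)
  ultimately show ?thesis by (metis order_refl)
qed

text \<open>The chain is p ~ w ~ w' ~ q: the outer links change whole blocks by kernel vectors, the
  middle link is \<open>m\<close> copies of \<tau>.\<close>

lemma (in mpoly_ideal_lessThan) cong_if_block_kernel_sum_multiple:
  assumes s: "sum_list (map dim_col As) \<le> s"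
    and gens: "\<And>i \<alpha>. i < length As \<Longrightarrow> \<alpha> \<in> block_kernel s As i \<Longrightarrow> pure_binomial 0 \<alpha> \<in> J"
    and \<tau>: "\<tau> \<in> carrier_vec s" "pure_binomial 0 \<tau> \<in> J"
    and sign: "\<And>i. i < length As \<Longrightarrow> block_cols As i \<inter> supp (pos_part \<tau>) = {} \<or>
                       block_cols As i \<inter> supp (neg_part \<tau>) = {}"
    and v: "v \<in> block_kernel_sum s As"
    and pq: "p \<in> carrier_vec s" "q \<in> carrier_vec s"
    and diff: "\<And>j. j < s \<Longrightarrow> int (p $ j) - int (q $ j) = v $ j + int m * \<tau> $ j"
  shows "cong p q"
proof -
  \<comment> \<open>A block that misses the support of one part of \<tau> carries entries of only
    one weak sign.\<close>
  have block_sign: "(\<forall>j\<in>block_cols As i. 0 \<le> \<tau> $ j) \<or> (\<forall>j\<in>block_cols As i. \<tau> $ j \<le> 0)"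
    if "i < length As" for i
  proof -
    have "j < s" if "j \<in> block_cols As i" for j
      using that block_bound[OF \<open>i < length As\<close>] s by (auto simp: block_cols_def)
    then show ?thesis
      using sign[OF that] \<tau>(1) by (fastforce simp: supp_def)
  qed
  \<comment> \<open>The condition on whole blocks matters where \<tau> is 0: a zero in a block with
    a negative entry stays outside \<open>P\<close>, so \<open>P\<close> never splits a block.
    Indices outside all blocks are sorted by their own sign.\<close>
  define P where "P = {j. 0 \<le> \<tau> $ j \<and>
    (\<forall>i<length As. j \<in> block_cols As i \<longrightarrow> (\<forall>j'\<in>block_cols As i. 0 \<le> \<tau> $ j'))}"
  \<comment> \<open>An index outside \<open>P\<close> has a negative entry itself or shares a block
    with one; in the latter case \<open>block_sign\<close> applies.\<close>
  have nonpos: "\<tau> $ j \<le> 0" if "j \<notin> P" for j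
    using that block_sign by (force simp: P_def)
  have P_block: "block_cols As i \<subseteq> P \<or> block_cols As i \<inter> P = {}" if i: "i < length As" for i
  proof (cases "\<forall>j'\<in>block_cols As i. 0 \<le> \<tau> $ j'")
    case True
    have "i' = i" if "j \<in> block_cols As i" "j \<in> block_cols As i'" "i' < length As" for i' j
      using block_cols_disjoint[OF i, of i'] that by blast
    then show ?thesis using True by (auto simp: P_def)
  qed (use i in \<open>auto simp: P_def\<close>)
  \<comment> \<open>On \<open>P\<close> the whole multiple of \<open>\<tau>\<close> is added to \<open>q\<close>, off \<open>P\<close> it is subtracted from \<open>p\<close>;
    the sign condition keeps both exponent vectors nonnegative.\<close>
  define w where "w = vec s (\<lambda>j. if j \<in> P then q $ j + m * nat (\<tau> $ j) else p $ j)"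
  define w' where "w' = vec s (\<lambda>j. if j \<in> P then q $ j else p $ j + m * nat (- \<tau> $ j))"
  have w_carrier: "w \<in> carrier_vec s" "w' \<in> carrier_vec s" by (simp_all add: w_def w'_def)
  define restrict where "restrict Q = vec s (\<lambda>j. if j \<in> Q then v $ j else 0)" for Q :: "nat set"
  \<comment> \<open>A set \<open>Q\<close> that splits no block leaves each block of
    \<open>v\<close> unchanged or makes it zero, and both lie in the kernel.\<close>
  have restrict: "restrict Q \<in> block_kernel_sum s As"
    if Q: "\<And>i. i < length As \<Longrightarrow> block_cols As i \<subseteq> Q \<or> block_cols As i \<inter> Q = {}" for Q
  proof -
    have "block_vec As i (restrict Q) \<in> mat_kernel (As ! i)" if i: "i < length As" for i
    proof (cases "block_cols As i \<subseteq> Q")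
      case True
      have "block_vec As i (restrict Q) = block_vec As i v"
      proof (rule eq_vecI)
        fix c assume "c < dim_vec (block_vec As i v)"
        then have c: "c < dim_col (As ! i)" by (simp add: block_vec_def)
        then have "block_offset As i + c \<in> Q" using True by (force simp: block_cols_def)
        then show "block_vec As i (restrict Q) $ c = block_vec As i v $ c"
          using c block_bound[OF i] s by (simp add: block_vec_def restrict_def)
      qed (simp add: block_vec_def)
      then show ?thesis using v i by (simp add: block_kernel_sum_def)
    next
      case False
      then have "block_cols As i \<inter> Q = {}" using Q[OF i] by blast
      moreover have "block_offset As i + c \<in> block_cols As i" if "c < dim_col (As ! i)" for c
        using that by (simp add: block_cols_def)
      ultimately have "block_offset As i + c \<notin> Q" if "c < dim_col (As ! i)" for c
        using that by blast
      then have "block_vec As i (restrict Q) = 0\<^sub>v (dim_col (As ! i))"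
        using block_bound[OF i] s
        by (auto simp: block_vec_def restrict_def intro!: eq_vecI)
      then show ?thesis by (simp add: mat_kernel_zero)
    qed
    then show ?thesis using v by (auto simp: block_kernel_sum_def restrict_def)
  qed
  \<comment> \<open>On \<open>P\<close>, p - w = p - q - m\<tau> = v; elsewhere p = w.\<close>
  have "cong p w"
    using diff P_block
    by (intro cong_if_block_kernel_sum[OF s gens restrict[of P] pq(1) w_carrier(1)])
       (auto simp: w_def restrict_def P_def algebra_simps)
  moreover have "cong w w'"
  proof (rule cong_if_multiple[OF \<tau>(2,1) w_carrier])
    show "int (w $ j) - int (w' $ j) = int m * \<tau> $ j" if "j < s" for j
      using that nonpos[of j] by (auto simp: w_def w'_def P_def)
  qed
  \<comment> \<open>The complement of \<open>P\<close> splits no block either; there w' - q = p - q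
    - m\<tau> = v, and on \<open>P\<close> w' = q.\<close>
  moreover have "cong w' q"
    using diff P_block nonpos
    by (intro cong_if_block_kernel_sum[OF s gens restrict[of "- P"] w_carrier(2) pq(2)])
       (auto simp: w'_def restrict_def algebra_simps)
  ultimately show ?thesis by (blast intro: cong_trans)
qed


section \<open>Internal direct lsums\<close>

text \<open>An element of one summand is the sum of the list holding it in that position and zeros
  elsewhere.\<close>

lemma summand_subset_internal_direct_sum:
  assumes "internal_direct_sum s Hs G"
    and "\<And>H. H \<in> set Hs \<Longrightarrow> H \<subseteq> carrier_vec s \<and> 0\<^sub>v s \<in> H"
    and "H \<in> set Hs"
  shows "H \<subseteq> G"
proof
  fix h assume h: "h \<in> H"
  define lsums :: "int vec set list \<Rightarrow> int vec set"
    where "lsums Hs = (\<lambda>hs. foldr (+) hs (0\<^sub>v s)) ` listset Hs" for Hs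
  have lsums_Cons: "v + w \<in> lsums (H # Hs)" if v: "v \<in> H" and "w \<in> lsums Hs" for v w H Hs
  proof -
    obtain hs where "hs \<in> listset Hs" and w: "w = foldr (+) hs (0\<^sub>v s)"
      using \<open>w \<in> lsums Hs\<close> unfolding lsums_def by (rule imageE)
    with v have "v # hs \<in> listset (H # Hs)" by (simp add: set_Cons_def)
    then have "foldr (+) (v # hs) (0\<^sub>v s) \<in> lsums (H # Hs)" unfolding lsums_def by (rule imageI)
    then show ?thesis by (simp add: w)
  qed
  have zeros: "0\<^sub>v s \<in> lsums Hs" if "\<And>H. H \<in> set Hs \<Longrightarrow> 0\<^sub>v s \<in> H" for Hs
    using that
  proof (induction Hs)
    case Nil
    then show ?case by (simp add: lsums_def)
  next
    case (Cons H Hs)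
    then show ?case using lsums_Cons[of "0\<^sub>v s" H "0\<^sub>v s" Hs] by simp
  qed
  have "h \<in> lsums Hs"
    using assms(2,3)
  proof (induction Hs)
    case (Cons H' Hs)
    have carr: "h \<in> carrier_vec s" using Cons.prems h by blast
    show ?case
    proof (cases "H = H'")
      case True
      then show ?thesis
        using lsums_Cons[of h H' "0\<^sub>v s" Hs] zeros[of Hs] Cons.prems(1) h carr by simp
    next
      case False
      then have "h \<in> lsums Hs" using Cons by simp
      then show ?thesis using lsums_Cons[of "0\<^sub>v s" H' h Hs] Cons.prems(1) carr by simp
    qed
  qed simp
  then show "h \<in> G"
    using assms(1) by (simp add: lsums_def internal_direct_sum_def bij_betw_def)
qed

text \<open>Splits off the last summand and absorbs all earlier ones into \<open>S\<close>. It is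
  meant for \<open>S\<close> the sum of the block kernels and \<open>H\<close> the multiples of
  \<tau>.\<close>

lemma foldr_listset_append:
  assumes "hs \<in> listset (Hs @ [H])" and "H \<subseteq> carrier_vec s"
    and S0: "0\<^sub>v s \<in> S" and S_add: "\<And>v w. v \<in> S \<Longrightarrow> w \<in> S \<Longrightarrow> v + w \<in> S"
    and "S \<subseteq> carrier_vec s" and "\<And>H. H \<in> set Hs \<Longrightarrow> H \<subseteq> S"
  shows "\<exists>v\<in>S. \<exists>t\<in>H. foldr (+) hs (0\<^sub>v s) = v + (t :: int vec)"
  using assms(1,6)
proof (induction Hs arbitrary: hs)
  case Nil
  then obtain t where "t \<in> H" "hs = [t]" by (auto simp: set_Cons_def)
  then show ?case using S0 assms(2) by (intro bexI[of _ "0\<^sub>v s"] bexI[of _ t]) auto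
next
  case (Cons H' Hs)
  then obtain h hs' where h: "h \<in> H'" "hs' \<in> listset (Hs @ [H])" "hs = h # hs'"
    by (auto simp: set_Cons_def)
  have sub: "H' \<subseteq> S" and "\<And>H. H \<in> set Hs \<Longrightarrow> H \<subseteq> S" using Cons.prems(2) by simp_all
  with Cons.IH[OF h(2)]
  obtain v t where vt: "v \<in> S" "t \<in> H" "foldr (+) hs' (0\<^sub>v s) = v + t"
    by blast
  have "h \<in> S" using h(1) sub by blast
  moreover have "h \<in> carrier_vec s" "v \<in> carrier_vec s" "t \<in> carrier_vec s"
    using \<open>h \<in> S\<close> vt(1,2) assms(2,5) by blast+
  ultimately have "foldr (+) hs (0\<^sub>v s) = (h + v) + t"
    by (simp add: h(3) vt(3) assoc_add_vec[of h s v t])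
  then show ?case using S_add[OF \<open>h \<in> S\<close> vt(1)] vt(2) by blast
qed


section \<open>The toric ideal of the bordered block matrix\<close>

lemma pure_binomial_mat_kernel_carrier:
  "pure_binomial off ` mat_kernel A \<subseteq> carrier (mpoly_ring {off..<off + dim_col A})"
proof safe
  fix \<alpha> assume "\<alpha> \<in> mat_kernel A"
  then have "dim_vec \<alpha> = dim_col A" by (simp add: mat_kernel_def)
  then show "pure_binomial off \<alpha> \<in> carrier (mpoly_ring {off..<off + dim_col A})"
    using pure_binomial_carrier[of off \<alpha>] by simp
qed

text \<open>\<open>K\<close> contracts to an ideal of the smaller ring in which the toric ideal is
  generated, so minimality there reduces containment to the generators.\<close>

lemma toric_ideal_at_subset_iff:
  fixes K :: "'k::comm_ring_1 mpoly set"
  assumes K: "ideal K (mpoly_ring V)" and "{off..<off + dim_col A} \<subseteq> V"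
  shows "toric_ideal_at off A \<subseteq> K \<longleftrightarrow> pure_binomial off ` mat_kernel A \<subseteq> K"
proof -
  let ?W = "{off..<off + dim_col A}"
  interpret mpoly_ideal V K using K by (rule mpoly_ideal.intro)
  interpret W: ring "mpoly_ring ?W :: 'k mpoly ring" by (rule mpoly_ring_ring)
  have gens: "(pure_binomial off ` mat_kernel A :: 'k mpoly set) \<subseteq> carrier (mpoly_ring ?W)"
    by (rule pure_binomial_mat_kernel_carrier)
  show ?thesis
  proof
    assume "toric_ideal_at off A \<subseteq> K"
    then show "pure_binomial off ` mat_kernel A \<subseteq> K"
      using W.genideal_self[OF gens] unfolding toric_ideal_at_def by (rule subset_trans[rotated])
  next
    assume "pure_binomial off ` mat_kernel A \<subseteq> K"
    then have "toric_ideal_at off A \<subseteq> K \<inter> carrier (mpoly_ring ?W)"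
      unfolding toric_ideal_at_def
      using gens by (intro W.genideal_minimal[OF ideal_contract[OF assms(2)]]) simp
    then show "toric_ideal_at off A \<subseteq> K" by simp
  qed
qed

lemma toric_ideal_at_carrier:
  "toric_ideal_at off A \<subseteq> carrier (mpoly_ring {off..<off + dim_col A})"
proof -
  interpret ring "mpoly_ring {off..<off + dim_col A} :: 'a mpoly ring" by (rule mpoly_ring_ring)
  show ?thesis
    \<comment> \<open>The whole ring serves as the ideal \<open>K\<close>.\<close>
    unfolding toric_ideal_at_subset_iff[OF oneideal order_refl]
    by (rule pure_binomial_mat_kernel_carrier)
qed

text \<open>Generation happens twice, first in the variables of the block and then in the full ring;
  for containment in an ideal of the full ring both stages reduce to the same binomials.\<close>

lemma block_toric_ideal_ideal:
  fixes s As i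
  defines "I \<equiv> block_toric_ideal s As i :: 'k::comm_ring_1 mpoly set"
  assumes i: "i < length As" and s: "sum_list (map dim_col As) \<le> s"
  shows "ideal I (mpoly_ring {..<s})"
    and "ideal K (mpoly_ring {..<s}) \<Longrightarrow>
      I \<subseteq> K \<longleftrightarrow> pure_binomial 0 ` block_kernel s As i \<subseteq> K"
proof -
  interpret ring "mpoly_ring {..<s} :: 'k mpoly ring" by (rule mpoly_ring_ring)
  let ?off = "block_offset As i"
  let ?T = "toric_ideal_at ?off (As ! i) :: 'k mpoly set"
  have sub: "{?off..<?off + dim_col (As ! i)} \<subseteq> {..<s}"
    using block_bound[OF i] s by auto
  have T: "?T \<subseteq> carrier (mpoly_ring {..<s})"
    using toric_ideal_at_carrier mpoly_ring_carrier_mono[OF sub] by blast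
  show "ideal I (mpoly_ring {..<s})"
    unfolding I_def block_toric_ideal_def by (rule genideal_ideal[OF T])
  have img: "pure_binomial 0 ` block_kernel s As i =
      (pure_binomial ?off ` mat_kernel (As ! i) :: 'k mpoly set)"
    using block_bound[OF i] s unfolding block_kernel_def image_image
    by (intro image_cong refl pure_binomial_embed_vec) (auto simp: mat_kernel_def)
  show "I \<subseteq> K \<longleftrightarrow> pure_binomial 0 ` block_kernel s As i \<subseteq> K"
    if K: "ideal K (mpoly_ring {..<s})"
  proof -
    have "I \<subseteq> K \<longleftrightarrow> ?T \<subseteq> K"
      unfolding I_def block_toric_ideal_def
      using genideal_self[OF T] genideal_minimal[OF K, of ?T] by (meson subset_trans)
    then show ?thesis by (simp add: img toric_ideal_at_subset_iff[OF K sub])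
  qed
qed

theorem lemma3p4:
  fixes As :: "int mat list" and cs :: "int vec list" and N s :: nat
    and A :: "int mat" and \<tau> :: "int vec"
  assumes "set cs \<subseteq> carrier_vec N"
    and "sum_list (map dim_row As) \<le> N"
    and "s = sum_list (map dim_col As) + length cs"
    and "A = bordered_block_mat N As cs"
    and "\<tau> \<in> carrier_vec s"
    and "internal_direct_sum s
           (map (block_kernel s As) [0..<length As] @ [{m \<cdot>\<^sub>v \<tau> | m. True}])
           (mat_kernel A)"
    and "\<forall>i<length As. block_cols As i \<inter> supp (pos_part \<tau>) = {} \<or>
                       block_cols As i \<inter> supp (neg_part \<tau>) = {}"
  shows "(toric_ideal A :: 'k::{alg_closed_field, field_char_0} mpoly set) =
           foldr (set_add (mpoly_ring {..<s}))
             (map (block_toric_ideal s As) [0..<length As])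
             (genideal (mpoly_ring {..<s}) {pure_binomial 0 \<tau>})"
proof -
  let ?R = "mpoly_ring {..<s} :: 'k mpoly ring"
  let ?Is = "map (block_toric_ideal s As) [0..<length As] :: 'k mpoly set list"
  let ?G = "genideal ?R {pure_binomial 0 \<tau>}"
  let ?Z = "{m \<cdot>\<^sub>v \<tau> | m. True}"
  let ?Hs = "map (block_kernel s As) [0..<length As] @ [?Z]"
  define J where "J = foldr (set_add ?R) ?Is ?G"
  interpret ring ?R by (rule mpoly_ring_ring)
  have s: "sum_list (map dim_col As) \<le> s" using assms(3) by simp
  \<comment> \<open>The toric ideal of \<open>A\<close> therefore lives in the same ring as the sum
    of ideals.\<close>
  have dim_A: "dim_col A = s"
    using assms(3,4) by (simp add: bordered_block_mat_def Let_def dim_diag_block_mat)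
  have \<tau>_carrier: "pure_binomial 0 \<tau> \<in> carrier ?R"
    using pure_binomial_carrier[of 0 \<tau>] assms(5) by (simp add: atLeast0LessThan)
  have G: "ideal ?G ?R" using \<tau>_carrier by (intro genideal_ideal) simp
  have Is: "ideal I ?R" if I: "I \<in> set ?Is" for I
  proof -
    obtain i where "i < length As" "I = block_toric_ideal s As i" using I by auto
    then show ?thesis using block_toric_ideal_ideal(1)[OF _ s] by blast
  qed
  have J_ideal: "ideal J ?R"
    unfolding J_def by (rule foldr_set_add_ideals(1)[OF mpoly_ring_ring G Is])
  have J_sup: "?G \<union> \<Union>(set ?Is) \<subseteq> J"
    unfolding J_def by (rule foldr_set_add_ideals(2)[OF mpoly_ring_ring G Is])
  have summands: "H \<subseteq> carrier_vec s \<and> 0\<^sub>v s \<in> H" if H: "H \<in> set ?Hs" for H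
  proof -
    have "embed_vec s off (0\<^sub>v d) = (0\<^sub>v s :: int vec)" for off d
      by (auto simp: embed_vec_def intro!: eq_vecI)
    then have block: "block_kernel s As i \<subseteq> carrier_vec s \<and> 0\<^sub>v s \<in> block_kernel s As i" for i
      unfolding block_kernel_def using mat_kernel_zero[of "As ! i"]
      by (metis (no_types, lifting) embed_vec_def image_eqI image_subsetI vec_carrier)
    have "0\<^sub>v s = 0 \<cdot>\<^sub>v \<tau>" using assms(5) by (intro eq_vecI) auto
    then have "0\<^sub>v s \<in> ?Z" by blast
    moreover have "?Z \<subseteq> carrier_vec s" using assms(5) by auto
    ultimately have Z: "?Z \<subseteq> carrier_vec s \<and> 0\<^sub>v s \<in> ?Z" by (rule conjI[rotated])
    consider "H = ?Z" | i where "H = block_kernel s As i" using H by auto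
    then show ?thesis using block Z by cases simp_all
  qed
  have kernel_sub: "H \<subseteq> mat_kernel A" if "H \<in> set ?Hs" for H
    using summand_subset_internal_direct_sum[OF assms(6) summands that] .

  \<comment> \<open>Each direct summand lies in the kernel of \<open>A\<close>, so all generators of
    \<open>J\<close> are among those of the toric ideal.\<close>
  have "J \<subseteq> toric_ideal A"
  proof -
    let ?T = "toric_ideal A :: 'k mpoly set"
    have gens: "pure_binomial 0 ` mat_kernel A \<subseteq> carrier ?R"
      using pure_binomial_mat_kernel_carrier[of 0 A] dim_A by (simp add: atLeast0LessThan)
    have T: "ideal ?T ?R" and gens_T: "pure_binomial 0 ` mat_kernel A \<subseteq> ?T"
      using genideal_ideal[OF gens] genideal_self[OF gens]
      by (simp_all add: toric_ideal_at_def dim_A atLeast0LessThan)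
    have "1 \<cdot>\<^sub>v \<tau> \<in> ?Z" by blast
    moreover have "?Z \<subseteq> mat_kernel A" by (rule kernel_sub) simp
    ultimately have "1 \<cdot>\<^sub>v \<tau> \<in> mat_kernel A" by (rule rev_subsetD)
    then have "\<tau> \<in> mat_kernel A" by simp
    then have "?G \<subseteq> ?T" using gens_T by (intro genideal_minimal T) auto
    moreover have "I \<subseteq> ?T" if mem: "I \<in> set ?Is" for I
    proof -
      obtain i where i: "i < length As" and I: "I = block_toric_ideal s As i" using mem by auto
      have "block_kernel s As i \<subseteq> mat_kernel A" using i by (intro kernel_sub) simp
      then show ?thesis
        unfolding I block_toric_ideal_ideal(2)[OF i s T] using gens_T by blast
    qed
    ultimately show ?thesis unfolding J_def by (intro foldr_set_add_least T)
  qed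
  \<comment> \<open>It suffices to treat the binomial of each kernel vector \<alpha>, that is, to
    show \<alpha>_+ ~ \<alpha>_-.\<close>
  moreover have "toric_ideal A \<subseteq> J"
  proof -
    interpret mpoly_ideal_lessThan s J
      using J_ideal by (intro mpoly_ideal_lessThan.intro mpoly_ideal.intro)
    have \<tau>_J: "pure_binomial 0 \<tau> \<in> J" using J_sup genideal_self'[OF \<tau>_carrier] by blast
    have gens: "pure_binomial 0 \<alpha> \<in> J" if "i < length As" "\<alpha> \<in> block_kernel s As i" for i \<alpha>
    proof -
      have "block_toric_ideal s As i \<in> set ?Is" using that(1) by simp
      then have "block_toric_ideal s As i \<subseteq> J" using J_sup by blast
      then show ?thesis using block_toric_ideal_ideal(2)[OF that(1) s J_ideal] that(2) by blast
    qed
    have main: "cong p q"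
      if "v \<in> block_kernel_sum s As" "p \<in> carrier_vec s" "q \<in> carrier_vec s"
        and "\<And>j. j < s \<Longrightarrow> int (p $ j) - int (q $ j) = v $ j + int m * \<tau> $ j"
      for v p q m
      by (rule cong_if_block_kernel_sum_multiple[where v = v and m = m and \<tau> = \<tau> and As = As])
         (use s gens assms(5,7) \<tau>_J that in blast)+
    have "pure_binomial 0 \<alpha> \<in> J" if \<alpha>: "\<alpha> \<in> mat_kernel A" for \<alpha>
    proof -
      have "\<alpha> \<in> (\<lambda>hs. foldr (+) hs (0\<^sub>v s)) ` listset ?Hs"
        using \<alpha> bij_betw_imp_surj_on[OF assms(6)[unfolded internal_direct_sum_def]] by blast
      then obtain hs where hs: "hs \<in> listset ?Hs" "\<alpha> = foldr (+) hs (0\<^sub>v s)"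
        by (elim imageE)
      \<comment> \<open>The summands of \<alpha> from the block kernels are collected into one
        vector \<open>v\<close>; what remains is a multiple of \<tau>.\<close>
      have "\<exists>v\<in>block_kernel_sum s As. \<exists>t\<in>?Z. foldr (+) hs (0\<^sub>v s) = v + t"
      proof (rule foldr_listset_append[OF hs(1)])
        show "?Z \<subseteq> carrier_vec s" using assms(5) by auto
        show "block_kernel_sum s As \<subseteq> carrier_vec s" by (auto simp: block_kernel_sum_def)
        show "H \<subseteq> block_kernel_sum s As"
          if "H \<in> set (map (block_kernel s As) [0..<length As])" for H
          using that by (auto dest!: subsetD[OF block_kernel_subset_sum[OF s], rotated])
      qed (rule zero_block_kernel_sum[OF s] add_block_kernel_sum[OF s]; assumption)+
      then obtain v m where v: "v \<in> block_kernel_sum s As" and \<alpha>_eq: "\<alpha> = v + m \<cdot>\<^sub>v \<tau>"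
        using hs(2) by blast
      have dim: "\<alpha> \<in> carrier_vec s" using \<alpha> dim_A by (auto simp: mat_kernel_def)
      have v_dim: "v \<in> carrier_vec s" using v by (simp add: block_kernel_sum_def)
      have diff: "int (pos_part \<alpha> $ j) - int (neg_part \<alpha> $ j) = v $ j + m * \<tau> $ j"
        if "j < s" for j
        using that dim assms(5) \<alpha>_eq by auto
      have parts: "pos_part \<alpha> \<in> carrier_vec s" "neg_part \<alpha> \<in> carrier_vec s"
        using dim by (auto intro: carrier_vecI)
      have "cong (pos_part \<alpha>) (neg_part \<alpha>)"
      \<comment> \<open>\<open>main\<close> takes a natural multiple. For negative \<open>m\<close>
        the two parts of \<alpha> are exchanged, which turns v + m\<tau> into -v +
        (-m)\<tau>.\<close>
      proof (cases "0 \<le> m")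
        case True
        then show ?thesis using diff by (intro main[OF v parts, of "nat m"]) simp
      next
        case False
        have "cong (neg_part \<alpha>) (pos_part \<alpha>)"
          using False diff v_dim
          by (intro main[OF uminus_block_kernel_sum[OF s v] parts(2,1), of "nat (- m)"])
             (simp add: algebra_simps)
        then show ?thesis by (rule cong_sym)
      qed
      then show ?thesis by (simp add: cong_parts_iff)
    qed
    then have "pure_binomial 0 ` mat_kernel A \<subseteq> J" by blast
    then show ?thesis
      by (simp add: toric_ideal_at_subset_iff[OF J_ideal] dim_A atLeast0LessThan)
  qed
  ultimately show ?thesis by (simp add: J_def)
qed

end
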